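(* Let $\Omega$ be a simply connected topological space, and let $\mathcal{U}$ be a covering of $\Omega$ consisting of path-connected open subsets of $\Omega$. For each $U\in\mathcal{U}$ let $f_U\colon U\to\mathbb{K}$ be a function, and suppose that for all $U,V\in\mathcal{U}$ with $U\cap V\neq\varnothing$ the function $f_V-f_U$ is constant on $U\cap V$. Then there exists a function $f\colon\Omega\to\mathbb{K}$ such that $f_U-f$ is constant on $U$ for all $U\in\mathcal{U}$.
   Context: $\mathbb{K}$ denotes the field of real or complex numbers ($\mathbb{K}=\mathbb{R}$ or $\mathbb{K}=\mathbb{C}$). Simply connected has its standard meaning (path-connected, and any two paths with the same endpoints are homotopic with fixed endpoints). The functions $f_U$ and $f$ are arbitrary functions (no continuity is assumed or asserted). *)

theory Defs
  imports "HOL-Analysis.Analysis"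
begin

(* HOL-Analysis defines simply_connected, via free homotopy of loops, only for subsets of a type
   of class topological_space. This is the version for an abstract topology, by homotopies of
   paths with fixed endpoints. Note that path_connected_space, and hence this predicate, admits
   the empty space. *)
definition simply_connected_space :: "'a topology \<Rightarrow> bool" where
  "simply_connected_space X \<longleftrightarrow>
     path_connected_space X \<and>
     (\<forall>p q. pathin X p \<and> pathin X q \<and> p 0 = q 0 \<and> p 1 = q 1 \<longrightarrow>
        homotopic_with (\<lambda>r. r 0 = p 0 \<and> r 1 = p 1) (top_of_set {0..1}) X p q)"

end

(* Call h a primitive along H : S -> X if, locally, h differs by a constant from the pullback of any
   f_U.  On a connected domain two primitives differ by a constant, so primitives on two closed
   pieces with connected intersection can be glued; by bisection every map from a rectangle has a
   primitive.  A primitive along a homotopy of paths with fixed endpoints is constant on the two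
   sides where the endpoints sit, hence its increment along a path depends only on the endpoints.
   The function f(x) is the increment along any path from a base point to x. *)
theory Submission
  imports Defs
begin

text \<open>Composition with this retraction extends a path on the unit interval to a continuous map
  on the whole line with the same values on the interval.\<close>

lemma continuous_map_clamp:
  "continuous_map euclideanreal (top_of_set {0..1}) (\<lambda>t. max 0 (min 1 t))"
  by (auto simp: continuous_map_in_subtopology intro!: continuous_intros)

section \<open>Primitives along maps into the covered space\<close>

locale local_functions =
  fixes X :: "'a topology" and \<U> :: "'a set set" and F :: "'a set \<Rightarrow> 'a \<Rightarrow> 'b::ab_group_add"
  assumes openin_cover: "U \<in> \<U> \<Longrightarrow> openin X U"
    and Union_cover: "\<Union>\<U> = topspace X"
    and compatible: "\<lbrakk>U \<in> \<U>; V \<in> \<U>; x \<in> U; x \<in> V; y \<in> U; y \<in> V\<rbrakk> \<Longrightarrow> F V x - F U x = F V y - F U y"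
begin

text \<open>Comparing increments at \<open>z\<close> avoids naming a local constant. The filter
  omits \<open>w = z\<close>, where the equation is trivial. Continuity of \<open>h\<close> is not
  asked for, since the functions \<open>F U\<close> are arbitrary.\<close>

definition primitive :: "('c::topological_space \<Rightarrow> 'a) \<Rightarrow> 'c set \<Rightarrow> ('c \<Rightarrow> 'b) \<Rightarrow> bool" where
  "primitive H S h \<longleftrightarrow> (\<forall>z\<in>S. \<forall>U\<in>\<U>. H z \<in> U \<longrightarrow>
     (\<forall>\<^sub>F w in at z within S. h w - h z = F U (H w) - F U (H z)))"

lemma primitive_compose:
  assumes "primitive H S h" and \<phi>: "continuous_on T \<phi>" "\<phi> ` T \<subseteq> S"
  shows "primitive (\<lambda>x. H (\<phi> x)) T (\<lambda>x. h (\<phi> x))"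
  unfolding primitive_def
proof (intro ballI impI)
  fix z U assume z: "z \<in> T" "U \<in> \<U>" "H (\<phi> z) \<in> U"
  then have "\<forall>\<^sub>F w in at (\<phi> z) within S. h w - h (\<phi> z) = F U (H w) - F U (H (\<phi> z))"
    using assms by (auto simp: primitive_def)
  then obtain A where A: "open A" "\<phi> z \<in> A"
      "\<And>w. \<lbrakk>w \<in> A; w \<in> S; w \<noteq> \<phi> z\<rbrakk> \<Longrightarrow> h w - h (\<phi> z) = F U (H w) - F U (H (\<phi> z))"
    by (auto simp: eventually_at_topological)
  have "\<forall>\<^sub>F w in at z within T. \<phi> w \<in> A"
    using \<phi>(1) z(1) A(1,2) by (auto simp: continuous_on_def intro: topological_tendstoD)
  moreover have "\<forall>\<^sub>F w in at z within T. w \<in> T"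
    by (auto simp: eventually_at_filter)
  ultimately show "\<forall>\<^sub>F w in at z within T. h (\<phi> w) - h (\<phi> z) = F U (H (\<phi> w)) - F U (H (\<phi> z))"
  proof eventually_elim
    case (elim w)
    \<comment> \<open>If \<open>\<phi> w = \<phi> z\<close>, the punctured neighbourhood of
      \<open>\<phi> z\<close> gives no information, but both differences vanish.\<close>
    then show ?case
      using A(3)[of "\<phi> w"] \<phi>(2) by (cases "\<phi> w = \<phi> z") auto
  qed
qed

lemma primitive_subset:
  assumes "primitive H S h" "T \<subseteq> S"
  shows "primitive H T h"
  using primitive_compose[OF assms(1), of T "\<lambda>x. x"] assms(2) by (simp add: continuous_on_id)

text \<open>Near each point both functions have the increments of the same \<open>F U\<close> after
  \<open>H\<close>, so \<open>h - k\<close> is locally constant, hence constant on the connected set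
  \<open>S\<close>.\<close>

lemma primitive_unique:
  assumes h: "primitive H S h" and k: "primitive H S k"
    and "connected S" "H ` S \<subseteq> topspace X" "z \<in> S" "w \<in> S"
  shows "h z - h w = k z - k w"
proof -
  have "(\<lambda>x. h x - k x) constant_on S"
  proof (rule locally_constant_imp_constant[OF \<open>connected S\<close>])
    fix a assume a: "a \<in> S"
    then obtain U where U: "U \<in> \<U>" "H a \<in> U"
      using assms(4) Union_cover by blast
    have "\<forall>\<^sub>F x in at a within S. h x - h a = F U (H x) - F U (H a)"
      "\<forall>\<^sub>F x in at a within S. k x - k a = F U (H x) - F U (H a)"
      using h k a U by (auto simp: primitive_def)
    then have "\<forall>\<^sub>F x in at a within S. h x - k x = h a - k a"
    proof eventually_elim
      case (elim x)
      then have "h x - h a = k x - k a" by simp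
      then show ?case by (simp add: algebra_simps)
    qed
    then obtain A where "open A" "a \<in> A" "\<And>x. \<lbrakk>x \<in> A; x \<noteq> a; x \<in> S\<rbrakk> \<Longrightarrow> h x - k x = h a - k a"
      by (auto simp: eventually_at_topological)
    then show "\<exists>T. openin (top_of_set S) T \<and> a \<in> T \<and> (\<forall>x\<in>T. h x - k x = h a - k a)"
      using a by (intro exI[of _ "S \<inter> A"]) auto
  qed
  then have "h z - k z = h w - k w"
    using assms(5,6) by (auto simp: constant_on_def)
  then show ?thesis by (simp add: algebra_simps)
qed

text \<open>Compatibility enters here: by continuity \<open>H\<close> stays in \<open>V\<close> near
  \<open>z\<close>, so its values lie in the overlap of \<open>U\<close> and \<open>V\<close>, where
  \<open>F U\<close> and \<open>F V\<close> have the same increments.\<close>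

lemma primitive_in_member:
  assumes H: "continuous_map (top_of_set S) X H" and U: "U \<in> \<U>" "H ` S \<subseteq> U"
  shows "primitive H S (\<lambda>x. F U (H x))"
  unfolding primitive_def
proof (intro ballI impI)
  fix z V assume z: "z \<in> S" "V \<in> \<U>" "H z \<in> V"
  have "openin (top_of_set S) {x \<in> S. H x \<in> V}"
    using openin_continuous_map_preimage[OF H openin_cover[OF z(2)]] by simp
  then obtain A where A: "open A" "{x \<in> S. H x \<in> V} = S \<inter> A"
    by (auto simp: openin_open)
  have "\<And>x. \<lbrakk>x \<in> A; x \<in> S\<rbrakk> \<Longrightarrow> F U (H x) - F U (H z) = F V (H x) - F V (H z)"
  proof -
    fix x assume "x \<in> A" "x \<in> S"
    then have "F V (H x) - F U (H x) = F V (H z) - F U (H z)"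
      using A(2) U z by (intro compatible) auto
    then show "F U (H x) - F U (H z) = F V (H x) - F V (H z)"
      by (simp add: algebra_simps)
  qed
  moreover have "z \<in> A" using A(2) z by auto
  ultimately show "\<forall>\<^sub>F w in at z within S. F U (H w) - F U (H z) = F V (H w) - F V (H z)"
    using A(1) by (auto simp: eventually_at_topological)
qed

text \<open>By uniqueness the two primitives differ by a constant \<open>c\<close> on the connected
  overlap; adding \<open>c\<close> to \<open>k\<close> makes them agree there. If the overlap is
  empty, any \<open>c\<close> will do.\<close>

lemma primitive_Un:
  assumes h: "primitive H S h" and k: "primitive H T k"
    and "closed S" "closed T" "connected (S \<inter> T)" "H ` (S \<union> T) \<subseteq> topspace X"
  shows "\<exists>g. primitive H (S \<union> T) g"
proof -
  obtain c where c: "\<And>x. \<lbrakk>x \<in> S; x \<in> T\<rbrakk> \<Longrightarrow> h x = k x + c"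
  proof (cases "S \<inter> T = {}")
    case False
    then obtain a where a: "a \<in> S \<inter> T" by blast
    have "h x = k x + (h a - k a)" if "x \<in> S" "x \<in> T" for x
    proof -
      have "h x - h a = k x - k a"
        by (rule primitive_unique[of H "S \<inter> T"])
          (use assms a that primitive_subset[OF h] primitive_subset[OF k] in auto)
      then show ?thesis by (simp add: algebra_simps)
    qed
    then show ?thesis using that by blast
  qed (use that in blast)
  define g where "g x = (if x \<in> S then h x else k x + c)" for x
  have gS: "g x = h x" if "x \<in> S" for x using that by (simp add: g_def)
  have gT: "g x = k x + c" if "x \<in> T" for x using that c by (simp add: g_def)
  \<comment> \<open>The filter at \<open>z\<close> within the union splits into one condition per
    piece. A point outside a closed piece is not a limit point of it, so the condition for that
    piece is vacuous.\<close>
  have "primitive H (S \<union> T) g"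
    unfolding primitive_def at_within_union eventually_sup
  proof (intro ballI impI conjI)
    fix z U assume z: "z \<in> S \<union> T" "U \<in> \<U>" "H z \<in> U"
    show "\<forall>\<^sub>F w in at z within S. g w - g z = F U (H w) - F U (H z)"
    proof (cases "z \<in> S")
      case True
      have "\<forall>\<^sub>F w in at z within S. h w - h z = F U (H w) - F U (H z)"
        using h z True by (auto simp: primitive_def)
      moreover have "\<forall>\<^sub>F w in at z within S. w \<in> S"
        by (auto simp: eventually_at_filter)
      ultimately show ?thesis
        by eventually_elim (use gS True in auto)
    next
      case False
      then have "at z within S = bot"
        using \<open>closed S\<close> by (metis closed_limpt trivial_limit_within)
      then show ?thesis by simp
    qed
    show "\<forall>\<^sub>F w in at z within T. g w - g z = F U (H w) - F U (H z)"
    proof (cases "z \<in> T")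
      case True
      have "\<forall>\<^sub>F w in at z within T. k w - k z = F U (H w) - F U (H z)"
        using k z True by (auto simp: primitive_def)
      moreover have "\<forall>\<^sub>F w in at z within T. w \<in> T"
        by (auto simp: eventually_at_filter)
      ultimately show ?thesis
        by eventually_elim (use gT True in auto)
    next
      case False
      then have "at z within T = bot"
        using \<open>closed T\<close> by (metis closed_limpt trivial_limit_within)
      then show ?thesis by simp
    qed
  qed
  then show ?thesis by blast
qed

section \<open>Existence of primitives by bisection\<close>

lemma primitive_rectangle_exists:
  fixes H :: "real \<times> real \<Rightarrow> 'a"
  assumes H: "continuous_map euclidean X H" and "a \<le> b" "c \<le> d"
  shows "\<exists>h. primitive H ({a..b} \<times> {c..d}) h"
proof -
  have X: "H ` S \<subseteq> topspace X" for S
    using H by (auto simp: continuous_map_def)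
  have glue: "\<exists>g. primitive H (S \<union> T) g"
    if "\<exists>h. primitive H S h" "\<exists>k. primitive H T k" "closed S" "closed T" "convex (S \<inter> T)" for S T
    using that primitive_Un X convex_connected by metis
  \<comment> \<open>Bisection in the first coordinate: rectangles sharing a vertical edge are glued
    along it, which leaves thin rectangles around each abscissa \<open>x\<close>.\<close>
  show ?thesis
    using \<open>a \<le> b\<close>
  proof (induction rule: Bolzano)
    case (trans a m b)
    have "{a..b} \<times> {c..d} = {a..m} \<times> {c..d} \<union> {m..b} \<times> {c..d}"
      using trans(3,4) by auto
    moreover have "({a..m} \<times> {c..d}) \<inter> ({m..b} \<times> {c..d}) = {m} \<times> {c..d}"
      using trans(3,4) by auto
    ultimately show ?case
      using glue[OF trans(1,2)] by (auto simp: closed_Times convex_Times)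
  next
    case (local x)
    \<comment> \<open>The second bisection concerns the claim that some positive bound on the width
      around \<open>x\<close> suffices for the height range \<open>{c..d}\<close>. Joining two
      ranges takes the minimum of the two bounds.\<close>
    show ?case
      using \<open>c \<le> d\<close>
    proof (induction rule: Bolzano)
      case (trans c m d)
      obtain e1 e2 where e: "e1 > 0" "e2 > 0"
        "\<And>a b. \<lbrakk>a \<le> x; x \<le> b; b - a < e1\<rbrakk> \<Longrightarrow> \<exists>h. primitive H ({a..b} \<times> {c..m}) h"
        "\<And>a b. \<lbrakk>a \<le> x; x \<le> b; b - a < e2\<rbrakk> \<Longrightarrow> \<exists>h. primitive H ({a..b} \<times> {m..d}) h"
        using trans(1,2) by blast
      have "\<exists>h. primitive H ({a..b} \<times> {c..d}) h" if "a \<le> x" "x \<le> b" "b - a < min e1 e2" for a b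
      proof -
        have "{a..b} \<times> {c..d} = {a..b} \<times> {c..m} \<union> {a..b} \<times> {m..d}"
          using trans(3,4) by auto
        moreover have "({a..b} \<times> {c..m}) \<inter> ({a..b} \<times> {m..d}) = {a..b} \<times> {m}"
          using trans(3,4) by auto
        ultimately show ?thesis
          using glue[OF e(3)[of a b] e(4)[of a b]] that by (auto simp: closed_Times convex_Times)
      qed
      then show ?case
        using e(1,2) by (intro exI[of _ "min e1 e2"]) auto
    next
      case (local y)
      \<comment> \<open>A small box around \<open>(x, y)\<close> is mapped into a single member
        \<open>U\<close> of the cover, where \<open>F U\<close> after \<open>H\<close> is itself a
        primitive.\<close>
      obtain U where U: "U \<in> \<U>" "H (x, y) \<in> U"
        using X[of UNIV] Union_cover by blast
      have "open (H -` U)"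
        using openin_continuous_map_preimage[OF H openin_cover[OF U(1)]] by (simp add: vimage_def)
      then obtain A B where AB: "open A" "open B" "x \<in> A" "y \<in> B" "A \<times> B \<subseteq> H -` U"
        using U(2) open_prod_elim[of "H -` U" "(x, y)"] by (metis mem_Sigma_iff vimageI)
      obtain e1 where e1: "e1 > 0" "\<And>t. \<bar>t - x\<bar> < e1 \<Longrightarrow> t \<in> A"
        using AB(1,3) by (auto simp: open_dist dist_real_def)
      obtain e2 where e2: "e2 > 0" "\<And>t. \<bar>t - y\<bar> < e2 \<Longrightarrow> t \<in> B"
        using AB(2,4) by (auto simp: open_dist dist_real_def)
      have "primitive H ({a..b} \<times> {c..d}) (\<lambda>z. F U (H z))"
        if "a \<le> x" "x \<le> b" "b - a < e1" "c \<le> y" "y \<le> d" "d - c < e2" for a b c d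
      proof (rule primitive_in_member)
        have "{a..b} \<subseteq> A" "{c..d} \<subseteq> B"
          using that by (auto intro!: e1(2) e2(2))
        then show "H ` ({a..b} \<times> {c..d}) \<subseteq> U"
          using AB(5) by blast
      qed (use H U in \<open>auto intro: continuous_map_from_subtopology\<close>)
      then show ?case
        using e1(1) e2(1) by blast
    qed
  qed
qed

text \<open>The path is read as a map of the square that ignores the first coordinate; a primitive
  on the square is then restricted to one edge.\<close>

lemma primitive_path_exists:
  fixes p :: "real \<Rightarrow> 'a"
  assumes "continuous_map euclidean X p"
  shows "\<exists>h. primitive p {0..1} h"
proof -
  have "continuous_map euclidean X (p \<circ> (snd :: real \<times> real \<Rightarrow> real))"
    by (rule continuous_map_compose[OF _ assms]) (auto intro!: continuous_intros)
  then obtain h where h: "primitive (p \<circ> (snd :: real \<times> real \<Rightarrow> real)) ({0..1} \<times> {0..1}) h"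
    using primitive_rectangle_exists[of "p \<circ> snd" 0 1 0 1] by auto
  have "primitive p {0..1} (\<lambda>t. h (0, t))"
    using primitive_compose[OF h, of "{0..1}" "\<lambda>t. (0, t)"]
    by (fastforce intro: continuous_intros)
  then show ?thesis by blast
qed

section \<open>Homotopy invariance of the increment\<close>

lemma primitive_const: "primitive (\<lambda>_. x) S (\<lambda>_. 0)"
  by (simp add: primitive_def)

text \<open>Two opposite edges of the homotopy square carry \<open>p\<close> and \<open>q\<close>,
  the other two carry constant paths. A primitive on the square has increment 0 along the latter, so
  its increments along the former agree.\<close>

lemma primitive_homotopic_paths:
  fixes p q :: "real \<Rightarrow> 'a"
  assumes hom: "homotopic_with (\<lambda>r. r 0 = p 0 \<and> r 1 = p 1) (top_of_set {0..1}) X p q"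
    and g: "primitive p {0..1} g" and k: "primitive q {0..1} k"
  shows "g 1 - g 0 = k 1 - k 0"
proof -
  obtain H0 :: "real \<times> real \<Rightarrow> 'a" where H0: "continuous_map (top_of_set ({0..1} \<times> {0..1})) X H0"
      "\<And>t. H0 (0, t) = p t" "\<And>t. H0 (1, t) = q t"
      "\<And>s. s \<in> {0..1} \<Longrightarrow> H0 (s, 0) = p 0" "\<And>s. s \<in> {0..1} \<Longrightarrow> H0 (s, 1) = p 1"
    using hom unfolding homotopic_with_def prod_topology_subtopology_eu by blast
  \<comment> \<open>Clamping both coordinates extends the homotopy to the whole plane, as the
    existence result for rectangles requires.\<close>
  define cl where "cl t = max 0 (min 1 t)" for t :: real
  define H where "H = H0 \<circ> (\<lambda>z. (cl (fst z), cl (snd z)))"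
  have cl: "cl t = t" if "t \<in> {0..1}" for t using that by (auto simp: cl_def)
  have H: "continuous_map euclidean X H"
    unfolding H_def
    by (rule continuous_map_compose[OF _ H0(1)])
      (auto simp: continuous_map_in_subtopology cl_def intro!: continuous_intros)
  then obtain h where h: "primitive H ({0..1} \<times> {0..1}) h"
    using primitive_rectangle_exists[of H 0 1 0 1] by auto
  \<comment> \<open>The restriction of \<open>h\<close> to an edge and the given \<open>l\<close>
    are primitives along the same path, so uniqueness equates their increments.\<close>
  have edge: "h (\<phi> 1) - h (\<phi> 0) = l 1 - l 0"
    if \<phi>: "continuous_on {0..1} \<phi>" "\<phi> ` {0..1} \<subseteq> {0..1} \<times> {0..1}"
      and r: "\<And>t. t \<in> {0..1} \<Longrightarrow> H (\<phi> t) = r t" and l: "primitive r {0..1} l"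
    for \<phi> r and l :: "real \<Rightarrow> 'b"
  proof -
    have "primitive (\<lambda>t. H (\<phi> t)) {0..1} l"
      using l r unfolding primitive_def
      by (auto elim!: eventually_mono[rotated] simp: eventually_at_filter)
    moreover have "(\<lambda>t. H (\<phi> t)) ` {0..1} \<subseteq> topspace X"
      using H by (auto simp: continuous_map_def)
    ultimately show ?thesis
      by (intro primitive_unique[OF primitive_compose[OF h \<phi>]]) auto
  qed
  have "h (0, 1) - h (0, 0) = g 1 - g 0"
    by (rule edge[of "\<lambda>t. (0, t)" p])
      (auto intro!: continuous_intros g simp: H_def cl H0)
  moreover have "h (1, 1) - h (1, 0) = k 1 - k 0"
    by (rule edge[of "\<lambda>t. (1, t)" q])
      (auto intro!: continuous_intros k simp: H_def cl H0)
  moreover have "h (1, 0) - h (0, 0) = 0 - 0"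
    by (rule edge[of "\<lambda>t. (t, 0)" "\<lambda>_. p 0" "\<lambda>_. 0"])
      (auto intro!: continuous_intros primitive_const simp: H_def cl H0)
  moreover have "h (1, 1) - h (0, 1) = 0 - 0"
    by (rule edge[of "\<lambda>t. (t, 1)" "\<lambda>_. p 1" "\<lambda>_. 0"])
      (auto intro!: continuous_intros primitive_const simp: H_def cl H0)
  ultimately show ?thesis by simp
qed

section \<open>Construction of the global function\<close>

lemma global_function_exists:
  assumes sc: "simply_connected_space X"
    and pc: "\<And>U. U \<in> \<U> \<Longrightarrow> path_connectedin X U"
  shows "\<exists>f. \<forall>U\<in>\<U>. (\<lambda>x. F U x - f x) constant_on U"
\<comment> \<open>The empty space counts as simply connected here, and it offers no base
  point.\<close>
proof (cases "topspace X = {}")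
  case True
  then have "U = {}" if "U \<in> \<U>" for U using that Union_cover by blast
  then show ?thesis by (auto simp: constant_on_def)
next
  case False
  then obtain a where a: "a \<in> topspace X" by blast
  have "\<exists>p. continuous_map euclideanreal X p \<and> p 0 = a \<and> p 1 = x" if x: "x \<in> topspace X" for x
  proof -
    obtain p where p: "pathin X p" "p 0 = a" "p 1 = x"
      using sc a x unfolding simply_connected_space_def path_connected_space_def by blast
    then show ?thesis
      using continuous_map_compose[OF continuous_map_clamp, of X p]
      by (intro exI[of _ "p \<circ> (\<lambda>t. max 0 (min 1 t))"]) (auto simp: pathin_def)
  qed
  then obtain P where P: "\<And>x. x \<in> topspace X \<Longrightarrow> continuous_map euclideanreal X (P x)"
      "\<And>x. x \<in> topspace X \<Longrightarrow> P x 0 = a" "\<And>x. x \<in> topspace X \<Longrightarrow> P x 1 = x"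
    by metis
  obtain G where G: "\<And>x. x \<in> topspace X \<Longrightarrow> primitive (P x) {0..1} (G x)"
    using primitive_path_exists[OF P(1)] by metis
  define f where "f x = G x 1 - G x 0" for x
  \<comment> \<open>Following \<open>P x\<close> by a path \<open>q\<close> inside \<open>U\<close>
    from \<open>x\<close> to \<open>y\<close> gives a path \<open>j\<close> with the endpoints of
    \<open>P y\<close>. The part along \<open>q\<close> contributes \<open>F U y - F U x\<close>,
    whence \<open>f y = f x + (F U y - F U x)\<close>.\<close>
  have main: "F U x - f x = F U y - f y" if U: "U \<in> \<U>" and xy: "x \<in> U" "y \<in> U" for U x y
  proof -
    have x: "x \<in> topspace X" and y: "y \<in> topspace X"
      using U xy Union_cover by auto
    obtain q0 where q0: "pathin X q0" "q0 ` {0..1} \<subseteq> U" "q0 0 = x" "q0 1 = y"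
      using pc[OF U] xy by (auto simp: path_connectedin) blast
    define q where "q = q0 \<circ> (\<lambda>t. max 0 (min 1 t))"
    have q: "continuous_map euclideanreal X q" "q 0 = x" "q 1 = y" "\<And>t. q t \<in> U"
      using q0 continuous_map_compose[OF continuous_map_clamp, of X q0]
      by (auto simp: q_def pathin_def image_subset_iff)
    define j where "j t = (if t \<le> 1/2 then (P x \<circ> (\<lambda>t. 2 * t)) t else (q \<circ> (\<lambda>t. 2 * t - 1)) t)" for t
    have j: "continuous_map euclideanreal X j"
      unfolding j_def
      by (intro continuous_map_cases_le continuous_map_from_subtopology
            continuous_map_compose[OF _ P(1)[OF x]] continuous_map_compose[OF _ q(1)])
        (auto intro!: continuous_intros simp: P(3) x q(2) mult.commute)
    obtain g where g: "primitive j {0..1} g"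
      using primitive_path_exists[OF j] by blast
    have jX: "j ` S \<subseteq> topspace X" "P x ` S \<subseteq> topspace X" "q ` S \<subseteq> topspace X" for S
      using j P(1)[OF x] q(1) by (auto simp: continuous_map_def)
    \<comment> \<open>The primitive \<open>g\<close> along \<open>j\<close> is reparametrized on
      each half of the interval and compared there with the known primitives along
      \<open>P x\<close> and \<open>q\<close>.\<close>
    have "primitive (\<lambda>t. j (t / 2)) {0..1} (\<lambda>t. g (t / 2))"
      by (rule primitive_compose[OF g]) (auto intro!: continuous_intros)
    then have "primitive (P x) {0..1} (\<lambda>t. g (t / 2))"
      by (auto elim!: eventually_mono[rotated] simp: eventually_at_filter primitive_def j_def)
    then have 1: "g (1/2) - g 0 = f x"
      using primitive_unique[OF _ G[OF x], of "\<lambda>t. g (t / 2)" 1 0] jX by (simp add: f_def)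
    have "primitive (\<lambda>t. j ((t + 1) / 2)) {0..1} (\<lambda>t. g ((t + 1) / 2))"
      by (rule primitive_compose[OF g]) (auto intro!: continuous_intros)
    \<comment> \<open>At \<open>t = 0\<close> the first branch of \<open>j\<close> applies; it
      agrees because \<open>P x 1 = x = q 0\<close>.\<close>
    moreover have "j ((t + 1) / 2) = q t" if "t \<in> {0..1}" for t
      using that x by (auto simp: j_def P(3) q(2) field_simps)
    ultimately have "primitive q {0..1} (\<lambda>t. g ((t + 1) / 2))"
      by (auto elim!: eventually_mono[rotated] simp: eventually_at_filter primitive_def)
    moreover have "primitive q {0..1} (\<lambda>t. F U (q t))"
      using q U by (intro primitive_in_member) (auto intro: continuous_map_from_subtopology)
    ultimately have "g ((1 + 1) / 2) - g ((0 + 1) / 2) = F U (q 1) - F U (q 0)"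
      by (rule primitive_unique) (use jX in auto)
    then have 2: "g 1 - g (1/2) = F U y - F U x"
      by (simp add: q)
    \<comment> \<open>Both paths run from \<open>a\<close> to \<open>y\<close>, so simple
      connectedness deforms one into the other.\<close>
    have "homotopic_with (\<lambda>r. r 0 = j 0 \<and> r 1 = j 1) (top_of_set {0..1}) X j (P y)"
    proof -
      have "pathin X j" "pathin X (P y)" "j 0 = P y 0" "j 1 = P y 1"
        using j P x y q by (auto simp: pathin_def j_def intro: continuous_map_from_subtopology)
      then show ?thesis
        using sc by (auto simp: simply_connected_space_def)
    qed
    then have "g 1 - g 0 = f y"
      unfolding f_def by (rule primitive_homotopic_paths[OF _ g G[OF y]])
    then have "f y = f x + (F U y - F U x)"
      using 1 2 by (metis add.commute diff_add_cancel add_diff_eq)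
    then show ?thesis by (simp add: algebra_simps)
  qed
  then have "(\<lambda>x. F U x - f x) constant_on U" if "U \<in> \<U>" for U
    using that unfolding constant_on_def by metis
  then show ?thesis by blast
qed

end

text \<open>The argument only adds and subtracts values, so an arbitrary abelian group serves as
  codomain and the real and complex cases are both instances.\<close>

lemma simply_connected_global_function_exists:
  fixes F :: "'a set \<Rightarrow> 'a \<Rightarrow> 'b::ab_group_add"
  assumes "simply_connected_space X"
    and cover: "\<And>U. U \<in> \<U> \<Longrightarrow> openin X U \<and> path_connectedin X U" "\<Union>\<U> = topspace X"
    and F: "\<forall>U\<in>\<U>. \<forall>V\<in>\<U>. U \<inter> V \<noteq> {} \<longrightarrow> (\<lambda>x. F V x - F U x) constant_on (U \<inter> V)"
  shows "\<exists>f. \<forall>U\<in>\<U>. (\<lambda>x. F U x - f x) constant_on U"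
proof -
  interpret local_functions X \<U> F
  proof
    fix U V x y assume UV: "U \<in> \<U>" "V \<in> \<U>" and "x \<in> U" "x \<in> V" "y \<in> U" "y \<in> V"
    then have xy: "x \<in> U \<inter> V" "y \<in> U \<inter> V" by auto
    then have "(\<lambda>x. F V x - F U x) constant_on (U \<inter> V)" using F UV by blast
    then show "F V x - F U x = F V y - F U y"
      using xy by (metis (no_types, lifting) constant_on_def)
  qed (use cover in auto)
  show ?thesis
    using assms by (intro global_function_exists) auto
qed

theorem corollary1p2:
  fixes \<Omega> :: "'a topology" and \<U> :: "'a set set"
  assumes "simply_connected_space \<Omega>"
    and "\<And>U. U \<in> \<U> \<Longrightarrow> openin \<Omega> U \<and> path_connectedin \<Omega> U"
    and "\<Union>\<U> = topspace \<Omega>"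
  shows
    "(\<forall>fU :: 'a set \<Rightarrow> 'a \<Rightarrow> real.
        (\<forall>U\<in>\<U>. \<forall>V\<in>\<U>. U \<inter> V \<noteq> {} \<longrightarrow> (\<lambda>x. fU V x - fU U x) constant_on (U \<inter> V)) \<longrightarrow>
        (\<exists>f :: 'a \<Rightarrow> real. \<forall>U\<in>\<U>. (\<lambda>x. fU U x - f x) constant_on U)) \<and>
     (\<forall>fU :: 'a set \<Rightarrow> 'a \<Rightarrow> complex.
        (\<forall>U\<in>\<U>. \<forall>V\<in>\<U>. U \<inter> V \<noteq> {} \<longrightarrow> (\<lambda>x. fU V x - fU U x) constant_on (U \<inter> V)) \<longrightarrow>
        (\<exists>f :: 'a \<Rightarrow> complex. \<forall>U\<in>\<U>. (\<lambda>x. fU U x - f x) constant_on U))"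
  by (intro conjI allI impI; rule simply_connected_global_function_exists[OF assms])

end
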